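(* Let $0<q<1$, let $P$ be a poset on $\{x_1,\dots,x_n\}$ and let $\omega_n:P\to[n]$ be the labeling $\omega_n(x_i)=i$. Let $r_1,\dots,r_n,s_1,\dots,s_n$ be integers with $r_i\ge s_i\ge 0$ and let $I=\{(x_1,\dots,x_n): q^{r_i}\le x_i\le q^{s_i}\}$. Then for every function $f$ of $n$ variables, \[ \int_{\mathcal O_I(P)} f(x_1,\dots,x_n)\, d_qx_1\cdots d_qx_n=(1-q)^n\sum_{\sigma} f(q^{\sigma(x_1)},\dots,q^{\sigma(x_n)})\,q^{|\sigma|}, \] where the sum is over all $(P,\omega_n)$-partitions $\sigma$ satisfying $s_i\le \sigma(x_i)<r_i$ for $1\le i\le n$.
   Context: For $0<q<1$, $\int_a^b g(x)\,d_qx=(1-q)\sum_{i\ge0}(g(bq^i)bq^i-g(aq^i)aq^i)$. For a convex polytope $D\subset\mathbb R^n$, $\int_D f\,d_qx_1\cdots d_qx_n$ is the iterated $q$-integral with $x_1$ innermost and $x_n$ outermost, where $x_i$ runs from the minimum to the maximum of $\{y_i:(y_1,\dots,y_n)\in D,\ y_j=x_j\ \forall j>i\}$. The truncated order polytope is $\mathcal O_I(P)=\{(x_1,\dots,x_n)\in I: x_i\le x_j \text{ whenever } x_i\le_P x_j\}$. For a labeling $\omega:P\to[n]$ (a bijection), a $(P,\omega)$-partition is a map $\sigma:P\to\{0,1,2,\dots\}$ with $\sigma(x)\ge\sigma(y)$ whenever $x\le_P y$, and $\sigma(x)>\sigma(y)$ whenever $x\le_P y$ and $\omega(x)>\omega(y)$;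 its size is $|\sigma|=\sum_{x\in P}\sigma(x)$.
   Formalization: For arbitrary f the claim fails (n=1, f(x)=1/x, I=[q,1]); it is proved for every f set to 0 outside the polytope, and for f itself when the sum over k of f(q^k,x_2,...,x_n)q^k converges for all points of the polytope; inner integrals over empty fibres are 0. *)

theory Defs
  imports "HOL-Analysis.Analysis"
begin

text \<open>
  A point \<open>(x\<^sub>1, \<dots>, x\<^sub>n)\<close> of n-dimensional space is a function in \<open>{1..n} \<rightarrow>\<^sub>E UNIV\<close>, and a poset on
  \<open>{x\<^sub>1, \<dots>, x\<^sub>n}\<close> is a relation \<open>P\<close> on the indices with \<open>partial_order_on {1..n} P\<close>, where
  \<open>(i, j) \<in> P\<close> means \<open>x\<^sub>i \<le>\<^sub>P x\<^sub>j\<close>.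
\<close>

definition q_integral :: "real \<Rightarrow> real \<Rightarrow> real \<Rightarrow> (real \<Rightarrow> real) \<Rightarrow> real" where
  "q_integral q a b g =
     (1 - q) * (\<Sum>i. g (b * q ^ i) * (b * q ^ i) - g (a * q ^ i) * (a * q ^ i))"

text \<open>The values of \<open>y\<^sub>i\<close> over the points \<open>y\<close> of \<open>D\<close> with \<open>y\<^sub>j = x\<^sub>j\<close> for all \<open>j > i\<close>.\<close>

definition fibre :: "nat \<Rightarrow> (nat \<Rightarrow> real) set \<Rightarrow> nat \<Rightarrow> (nat \<Rightarrow> real) \<Rightarrow> real set" where
  "fibre n D i x = {y i | y. y \<in> D \<and> (\<forall>j\<in>{i<..n}. y j = x j)}"

text \<open>
  \<open>iterated_q_integral q n D f k x\<close> integrates over the variables \<open>1, \<dots>, k\<close> with the variables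
  \<open>k+1, \<dots>, n\<close> held at their values in \<open>x\<close>. The q-integral from \<open>a\<close> to \<open>b\<close> also samples its
  integrand below \<open>a\<close>, where \<open>D\<close> may have no point with the given outer coordinates, so that the
  inner bounds do not exist; the inner integral is then an integral over the empty set, namely 0.
  A fibre of a convex polytope is compact, so if nonempty it has a minimum and a maximum.
\<close>

primrec iterated_q_integral ::
  "real \<Rightarrow> nat \<Rightarrow> (nat \<Rightarrow> real) set \<Rightarrow> ((nat \<Rightarrow> real) \<Rightarrow> real) \<Rightarrow> nat \<Rightarrow> (nat \<Rightarrow> real) \<Rightarrow> real"
where
  "iterated_q_integral q n D f 0 x = f x"
| "iterated_q_integral q n D f (Suc k) x =
     (let S = fibre n D (Suc k) x in
      if S = {} then 0
      else q_integral q (LEAST t. t \<in> S) (GREATEST t. t \<in> S)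
             (\<lambda>t. iterated_q_integral q n D f k (x(Suc k := t))))"

text \<open>
  The coordinates \<open>n, \<dots>, 1\<close> are all filled in, outermost first, so \<open>f\<close> is evaluated at elements of
  \<open>{1..n} \<rightarrow>\<^sub>E UNIV\<close> only.
\<close>

definition polytope_q_integral ::
  "real \<Rightarrow> nat \<Rightarrow> (nat \<Rightarrow> real) set \<Rightarrow> ((nat \<Rightarrow> real) \<Rightarrow> real) \<Rightarrow> real" where
  "polytope_q_integral q n D f = iterated_q_integral q n D f n (\<lambda>_. undefined)"

definition truncated_order_polytope ::
  "(nat \<Rightarrow> real) set \<Rightarrow> nat rel \<Rightarrow> (nat \<Rightarrow> real) set" where
  "truncated_order_polytope I P = {x \<in> I. \<forall>i j. (i, j) \<in> P \<longrightarrow> x i \<le> x j}"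

definition P_omega_partitions ::
  "'a set \<Rightarrow> 'a rel \<Rightarrow> ('a \<Rightarrow> nat) \<Rightarrow> ('a \<Rightarrow> nat) set" where
  "P_omega_partitions A P \<omega> =
     {\<sigma> \<in> A \<rightarrow>\<^sub>E UNIV.
        (\<forall>x y. (x, y) \<in> P \<longrightarrow> \<sigma> x \<ge> \<sigma> y) \<and>
        (\<forall>x y. (x, y) \<in> P \<and> \<omega> x > \<omega> y \<longrightarrow> \<sigma> x > \<sigma> y)}"

end

theory Submission
  imports Defs
begin

text \<open>
  If the outer coordinates are powers of \<open>q\<close>, then a nonempty fibre of \<open>D\<close> is an interval between two
  powers of \<open>q\<close>, so the q-integral over it telescopes to a finite sum over the exponents in between.
  The left endpoint is excluded from that sum and the right one is included. An outer variable bounds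
  the current one from below exactly where the labeling makes the inequality of the partition strict,
  and from above exactly where it is weak.
\<close>

text \<open>\<open>q_integral\<close> subtracts its two series term by term, so decay of
  \<open>g (q ^ m) * q ^ m\<close> gives convergence even where neither series converges by
  itself.\<close>

lemma q_integral_powers:
  fixes q :: real
  assumes "\<beta> \<le> \<alpha>" and lim: "(\<lambda>m. g (q ^ m) * q ^ m) \<longlonglongrightarrow> 0"
  shows "q_integral q (q ^ \<alpha>) (q ^ \<beta>) g = (1 - q) * (\<Sum>m\<in>{\<beta>..<\<alpha>}. g (q ^ m) * q ^ m)"
proof -
  define G where "G m = g (q ^ m) * q ^ m" for m
  define d where "d = \<alpha> - \<beta>"
  \<comment> \<open>\<open>H N\<close> is a window of \<open>d\<close> consecutive terms of
    \<open>G\<close>. Sliding it by one drops \<open>G (\<beta> + N)\<close> and gains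
    \<open>G (\<alpha> + N)\<close>, so the series of the q-integral telescopes in
    \<open>H\<close>.\<close>
  define H where "H N = (\<Sum>i<d. G (\<beta> + N + i))" for N
  have \<alpha>: "\<alpha> = \<beta> + d" using assms by (simp add: d_def)
  have "(\<lambda>N. G (N + (\<beta> + i))) \<longlonglongrightarrow> 0" for i
    using LIMSEQ_ignore_initial_segment[OF lim] by (simp add: G_def)
  then have "(\<lambda>N. \<Sum>i<d. G (N + (\<beta> + i))) \<longlonglongrightarrow> (\<Sum>i<d. 0)"
    by (intro tendsto_sum)
  then have "H \<longlonglongrightarrow> 0" by (simp add: H_def[abs_def] ac_simps)
  then have "(\<lambda>N. H N - H (Suc N)) sums (H 0 - 0)"
    by (rule telescope_sums')
  moreover have "H N - H (Suc N) = G (\<beta> + N) - G (\<alpha> + N)" for N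
  proof -
    have "G (\<beta> + N) + H (Suc N) = (\<Sum>i<Suc d. G (\<beta> + N + i))"
      unfolding H_def by (subst sum.lessThan_Suc_shift) simp
    also have "\<dots> = H N + G (\<alpha> + N)" by (simp add: H_def \<alpha> ac_simps)
    finally show ?thesis by simp
  qed
  ultimately have "(\<Sum>i. G (\<beta> + i) - G (\<alpha> + i)) = H 0"
    by (simp add: sums_iff)
  moreover have "H 0 = (\<Sum>m\<in>{\<beta>..<\<alpha>}. G m)"
    unfolding H_def \<alpha> using sum.shift_bounds_nat_ivl[of G 0 \<beta> d]
    by (simp add: atLeast0LessThan ac_simps)
  ultimately show ?thesis
    by (simp add: q_integral_def G_def power_add)
qed

text \<open>
  Clamping the coordinates comparable to \<open>k\<close> moves a given point of the fibre to any other point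
  allowed by the constraints that involve \<open>k\<close>.
\<close>

lemma fibre_truncated_order_polytope:
  fixes n :: nat and P :: "nat rel" and u v x :: "nat \<Rightarrow> real"
  defines "D \<equiv> truncated_order_polytope (\<Pi>\<^sub>E i\<in>{1..n}. {u i..v i}) P"
  assumes P: "partial_order_on {1..n} P" and k: "k \<in> {1..n}"
    and ne: "fibre n D k x \<noteq> {}"
  shows "fibre n D k x =
    {t. (\<forall>j. (j, k) \<in> P \<longrightarrow> (if j \<le> k then u j else x j) \<le> t) \<and>
        (\<forall>j. (k, j) \<in> P \<longrightarrow> t \<le> (if j \<le> k then v j else x j))}" (is "_ = ?T")
proof (intro equalityI subsetI)
  have sub: "i \<in> {1..n} \<and> j \<in> {1..n}" if "(i, j) \<in> P" for i j
    using P that by (auto simp: partial_order_on_def preorder_on_def)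
  have trans: "(i, j) \<in> P \<Longrightarrow> (j, l) \<in> P \<Longrightarrow> (i, l) \<in> P" for i j l
    using P by (meson partial_order_onD(2) transD)
  have antisym: "(i, j) \<in> P \<Longrightarrow> (j, i) \<in> P \<Longrightarrow> i = j" for i j
    using P by (meson partial_order_onD(3) antisymD)
  {
    fix t assume "t \<in> fibre n D k x"
    then obtain y where y: "y \<in> D" "\<forall>j\<in>{k<..n}. y j = x j" "t = y k"
      by (auto simp: fibre_def)
    have box: "u i \<le> y i \<and> y i \<le> v i" if "i \<in> {1..n}" for i
      using y(1) that by (auto simp: D_def truncated_order_polytope_def PiE_iff)
    have mono: "y i \<le> y j" if "(i, j) \<in> P" for i j
      using y(1) that by (auto simp: D_def truncated_order_polytope_def)
    show "t \<in> ?T"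
    proof (intro CollectI conjI allI impI)
      fix j assume j: "(j, k) \<in> P"
      then show "(if j \<le> k then u j else x j) \<le> t"
        using box[of j] mono[OF j] sub[OF j] y by auto
    next
      fix j assume j: "(k, j) \<in> P"
      then show "t \<le> (if j \<le> k then v j else x j)"
        using box[of j] mono[OF j] sub[OF j] y by auto
    qed
  }
  fix t assume t: "t \<in> ?T"
  obtain y where y: "y \<in> D" "\<forall>j\<in>{k<..n}. y j = x j"
    using ne by (auto simp: fibre_def)
  have box: "u i \<le> y i \<and> y i \<le> v i" if "i \<in> {1..n}" for i
    using y(1) that by (auto simp: D_def truncated_order_polytope_def PiE_iff)
  have mono: "y i \<le> y j" if "(i, j) \<in> P" for i j
    using y(1) that by (auto simp: D_def truncated_order_polytope_def)
  have ext: "y i = undefined" if "i \<notin> {1..n}" for i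
    using y(1) that by (auto simp: D_def truncated_order_polytope_def PiE_iff extensional_def)
  have lo: "u j \<le> t" if "(j, k) \<in> P" "j \<le> k" for j
    using t that by auto
  have lo': "y j \<le> t" if "(j, k) \<in> P" "k < j" for j
    using t that y(2) sub[OF that(1)] by auto
  have hi: "t \<le> v j" if "(k, j) \<in> P" "j \<le> k" for j
    using t that by auto
  have hi': "t \<le> y j" if "(k, j) \<in> P" "k < j" for j
    using t that y(2) sub[OF that(1)] by auto
  \<comment> \<open>Coordinates beyond \<open>k\<close> are prescribed by the fibre and stay put;
    only the inner ones are clamped. This \<open>z\<close> is the witness that \<open>t\<close> lies
    in the fibre.\<close>
  define z where "z i = (if i = k then t else if k < i then y i
      else if (i, k) \<in> P then min (y i) t else if (k, i) \<in> P then max (y i) t else y i)" for i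
  have kk: "(k, k) \<in> P"
    using P k by (meson partial_order_onD(1) refl_onD)
  have "z i \<in> {u i..v i}" if "i \<in> {1..n}" for i
    using box[OF that] lo[of i] hi[of i] kk
    by (auto simp: z_def min_def max_def)
  moreover have "z i = undefined" if "i \<notin> {1..n}" for i
    using that ext[OF that] sub k by (auto simp: z_def)
  moreover have "z i \<le> z j" if ij: "(i, j) \<in> P" for i j
  proof -
    \<comment> \<open>If \<open>j\<close> is capped at \<open>t\<close>, transitivity puts
      \<open>i\<close> below \<open>k\<close> as well, so \<open>i\<close> is capped too or, when
      \<open>k < i\<close>, satisfies \<open>y i \<le> t\<close> by \<open>lo'\<close>. A raised
      \<open>i\<close> is the dual case, with \<open>hi'\<close>.\<close>
    note m = mono[OF ij] trans[OF ij, of k] trans[OF _ ij, of k] lo'[of i] hi'[of j]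
    consider "i = k" | "j = k" | "i \<noteq> k" "j \<noteq> k" by blast
    then show ?thesis
    proof cases
      case 1
      then show ?thesis using ij hi'[of j] antisym[of j k] by (auto simp: z_def)
    next
      case 2
      then show ?thesis using ij lo'[of i] by (auto simp: z_def)
    next
      case 3
      then show ?thesis using m by (auto simp: z_def min_def max_def)
    qed
  qed
  ultimately have "z \<in> D"
    by (auto simp: D_def truncated_order_polytope_def PiE_iff extensional_def)
  moreover have "z k = t" "\<forall>j\<in>{k<..n}. z j = x j"
    using y(2) by (auto simp: z_def)
  ultimately show "t \<in> fibre n D k x"
    unfolding fibre_def by blast
qed

section \<open>Exponents of \<open>q\<close>: partitions, fibres and the induction over the
  variables\<close>

locale q_polytope =
  fixes q :: real and n :: nat and P :: "nat rel" and r s :: "nat \<Rightarrow> nat"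
  assumes q: "0 < q" "q < 1" and P: "partial_order_on {1..n} P"
begin

definition D :: "(nat \<Rightarrow> real) set" where
  "D = truncated_order_polytope (\<Pi>\<^sub>E i\<in>{1..n}. {q ^ r i .. q ^ s i}) P"

definition R :: "(nat \<Rightarrow> nat) set" where
  "R = {\<sigma>. \<sigma> \<in> P_omega_partitions {1..n} P (\<lambda>i. i) \<and> (\<forall>i\<in>{1..n}. s i \<le> \<sigma> i \<and> \<sigma> i < r i)}"

definition point :: "(nat \<Rightarrow> nat) \<Rightarrow> nat \<Rightarrow> real" where
  "point \<sigma> = (\<lambda>i\<in>{1..n}. q ^ \<sigma> i)"

text \<open>The conditions of \<open>R\<close> on the outer coordinates: vacuous for
  \<open>k = n\<close>, and for \<open>k = 0\<close> equivalent to
  \<open>restrict \<sigma> {1..n} \<in> R\<close>. Labels equal indices, so strictness is attached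
  to \<open>j < i\<close>.\<close>

definition consistent :: "nat \<Rightarrow> (nat \<Rightarrow> nat) \<Rightarrow> bool" where
  "consistent k \<sigma> \<longleftrightarrow>
     (\<forall>i\<in>{k<..n}. s i \<le> \<sigma> i \<and> \<sigma> i < r i) \<and>
     (\<forall>i\<in>{k<..n}. \<forall>j\<in>{k<..n}. (i, j) \<in> P \<longrightarrow> \<sigma> j \<le> \<sigma> i \<and> (j < i \<longrightarrow> \<sigma> j < \<sigma> i))"

definition extensions :: "nat \<Rightarrow> (nat \<Rightarrow> nat) \<Rightarrow> (nat \<Rightarrow> nat) set" where
  "extensions k \<sigma> = {\<rho>\<in>R. \<forall>i\<in>{k<..n}. \<rho> i = \<sigma> i}"

lemma P_sub: "(i, j) \<in> P \<Longrightarrow> i \<in> {1..n} \<and> j \<in> {1..n}"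
  using P by (auto simp: partial_order_on_def preorder_on_def)

lemma power_le_iff: "q ^ a \<le> q ^ b \<longleftrightarrow> b \<le> a"
  using q by (simp add: power_decreasing_iff)

lemma finite_R: "finite R"
proof (rule finite_subset)
  show "R \<subseteq> (\<Pi>\<^sub>E i\<in>{1..n}. {..<r i})"
    by (auto simp: R_def P_omega_partitions_def PiE_iff extensional_def)
qed (simp add: finite_PiE)

lemma R_D:
  assumes "\<rho> \<in> R"
  shows "i \<in> {1..n} \<Longrightarrow> s i \<le> \<rho> i" "i \<in> {1..n} \<Longrightarrow> \<rho> i < r i"
    "(i, j) \<in> P \<Longrightarrow> \<rho> j \<le> \<rho> i" "(i, j) \<in> P \<Longrightarrow> j < i \<Longrightarrow> \<rho> j < \<rho> i"
    "i \<notin> {1..n} \<Longrightarrow> \<rho> i = undefined"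
proof -
  have "\<rho> \<in> {1..n} \<rightarrow>\<^sub>E UNIV" "\<forall>i\<in>{1..n}. s i \<le> \<rho> i \<and> \<rho> i < r i"
    and "\<forall>i j. (i, j) \<in> P \<longrightarrow> \<rho> j \<le> \<rho> i" "\<forall>i j. (i, j) \<in> P \<and> j < i \<longrightarrow> \<rho> j < \<rho> i"
    using assms unfolding R_def P_omega_partitions_def by blast+
  then show "i \<in> {1..n} \<Longrightarrow> s i \<le> \<rho> i" "i \<in> {1..n} \<Longrightarrow> \<rho> i < r i"
    "(i, j) \<in> P \<Longrightarrow> \<rho> j \<le> \<rho> i" "(i, j) \<in> P \<Longrightarrow> j < i \<Longrightarrow> \<rho> j < \<rho> i"
    "i \<notin> {1..n} \<Longrightarrow> \<rho> i = undefined"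
    by (blast intro: PiE_arb)+
qed

lemma point_in_D: "\<rho> \<in> R \<Longrightarrow> point \<rho> \<in> D"
  using R_D[of \<rho>] P_sub less_imp_le[OF R_D(2)[of \<rho>]]
  by (auto simp: D_def truncated_order_polytope_def point_def PiE_iff power_le_iff)

text \<open>A point in the next inner fibre would have \<open>k\<close>-th coordinate
  \<open>x k\<close> and so witness \<open>x k\<close> in the fibre at \<open>k\<close>. Hence the
  inner fibre is empty and the convention for empty fibres gives 0. For \<open>k = 1\<close> there
  is no inner integral, and the integrand \<open>f\<close> itself is sampled.\<close>

lemma iterated_q_integral_outside:
  assumes "x k \<notin> fibre n D k x" "1 < k" "k \<le> n"
  shows "iterated_q_integral q n D f (k - 1) x = 0"
proof -
  obtain l where l: "k = Suc (Suc l)"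
    using assms(2) by (metis One_nat_def less_imp_Suc_add add_Suc)
  have "fibre n D (Suc l) x = {}"
  proof (rule ccontr)
    assume "fibre n D (Suc l) x \<noteq> {}"
    then obtain y where y: "y \<in> D" "\<forall>j\<in>{Suc l<..n}. y j = x j"
      by (auto simp: fibre_def)
    then have "y k = x k" "\<forall>j\<in>{k<..n}. y j = x j" using l assms(3) by auto
    with y(1) assms(1) show False by (force simp: fibre_def)
  qed
  then show ?thesis by (simp add: l)
qed

text \<open>All bounds given by \<open>fibre_truncated_order_polytope\<close> are powers of
  \<open>q\<close> here. Since exponents reverse the order, the sharpest lower bound has the least
  exponent, and dually. The ends are characterized through \<open>m < \<alpha>\<close> and
  \<open>\<beta> \<le> m\<close> because the sum over \<open>{\<beta>..<\<alpha>}\<close> is matched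
  with partition conditions on \<open>m\<close>.\<close>

lemma fibre_eq:
  assumes "k \<in> {1..n}" and x: "\<forall>i\<in>{k<..n}. x i = q ^ \<sigma> i" and ne: "fibre n D k x \<noteq> {}"
  obtains \<alpha> \<beta> where "fibre n D k x = {q ^ \<alpha>..q ^ \<beta>}" "\<beta> \<le> \<alpha>"
    "\<And>m. m < \<alpha> \<longleftrightarrow> (\<forall>j. (j, k) \<in> P \<longrightarrow> m < (if j \<le> k then r j else \<sigma> j))"
    "\<And>m. \<beta> \<le> m \<longleftrightarrow> (\<forall>j. (k, j) \<in> P \<longrightarrow> (if j \<le> k then s j else \<sigma> j) \<le> m)"
proof -
  define a where "a j = (if j \<le> k then r j else \<sigma> j)" for j
  define b where "b j = (if j \<le> k then s j else \<sigma> j)" for j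
  define \<alpha> where "\<alpha> = Min (a ` {j. (j, k) \<in> P})"
  define \<beta> where "\<beta> = Max (b ` {j. (k, j) \<in> P})"
  \<comment> \<open>This pair keeps \<open>Min\<close> and \<open>Max\<close> off the empty set; it
    contributes the box bounds \<open>r k\<close> and \<open>s k\<close>.\<close>
  have "(k, k) \<in> P"
    using P assms(1) by (meson partial_order_onD(1) refl_onD)
  then have nonempty: "a ` {j. (j, k) \<in> P} \<noteq> {}" "b ` {j. (k, j) \<in> P} \<noteq> {}"
    by auto
  have fin: "finite (a ` {j. (j, k) \<in> P})" "finite (b ` {j. (k, j) \<in> P})"
    by (rule finite_imageI, rule finite_subset[of _ "{1..n}"]; use P_sub in auto)+
  have 1: "m < \<alpha> \<longleftrightarrow> (\<forall>j. (j, k) \<in> P \<longrightarrow> m < a j)"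
    and 2: "m \<le> \<alpha> \<longleftrightarrow> (\<forall>j. (j, k) \<in> P \<longrightarrow> m \<le> a j)" for m
    using fin(1) nonempty(1) by (auto simp: \<alpha>_def)
  have 3: "\<beta> \<le> m \<longleftrightarrow> (\<forall>j. (k, j) \<in> P \<longrightarrow> b j \<le> m)" for m
    using fin(2) nonempty(2) by (auto simp: \<beta>_def)
  have 4: "\<alpha> \<in> a ` {j. (j, k) \<in> P}" "\<beta> \<in> b ` {j. (k, j) \<in> P}"
    unfolding \<alpha>_def \<beta>_def using fin nonempty by (blast intro: Min_in Max_in)+
  have lo: "(\<forall>j. (j, k) \<in> P \<longrightarrow> (if j \<le> k then q ^ r j else x j) \<le> t) \<longleftrightarrow> q ^ \<alpha> \<le> t" for t
  proof -
    have "(\<forall>j. (j, k) \<in> P \<longrightarrow> (if j \<le> k then q ^ r j else x j) \<le> t) \<longleftrightarrow>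
        (\<forall>j. (j, k) \<in> P \<longrightarrow> q ^ a j \<le> t)"
      using x P_sub by (auto simp: a_def)
    also have "\<dots> \<longleftrightarrow> q ^ \<alpha> \<le> t"
      using 4(1) 2[of \<alpha>] power_le_iff by (auto intro: order_trans)
    finally show ?thesis .
  qed
  have hi: "(\<forall>j. (k, j) \<in> P \<longrightarrow> t \<le> (if j \<le> k then q ^ s j else x j)) \<longleftrightarrow> t \<le> q ^ \<beta>" for t
  proof -
    have "(\<forall>j. (k, j) \<in> P \<longrightarrow> t \<le> (if j \<le> k then q ^ s j else x j)) \<longleftrightarrow>
        (\<forall>j. (k, j) \<in> P \<longrightarrow> t \<le> q ^ b j)"
      using x P_sub by (auto simp: b_def)
    also have "\<dots> \<longleftrightarrow> t \<le> q ^ \<beta>"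
      using 4(2) 3[of \<beta>] power_le_iff by (auto intro: order_trans)
    finally show ?thesis .
  qed
  have S: "fibre n D k x = {q ^ \<alpha>..q ^ \<beta>}"
  proof -
    have "fibre n D k x = {t. q ^ \<alpha> \<le> t \<and> t \<le> q ^ \<beta>}"
      using fibre_truncated_order_polytope[where u = "\<lambda>i. q ^ r i" and v = "\<lambda>i. q ^ s i",
          OF P assms(1) ne[unfolded D_def], folded D_def]
      by (simp only: lo hi)
    also have "\<dots> = {q ^ \<alpha>..q ^ \<beta>}" by auto
    finally show ?thesis .
  qed
  have "\<beta> \<le> \<alpha>"
    using ne unfolding S by (simp add: power_le_iff)
  show thesis
    by (rule that[OF S \<open>\<beta> \<le> \<alpha>\<close> 1[unfolded a_def] 3[unfolded b_def]])
qed

text \<open>Induction on the number of inner variables, for all admissible outer exponents at once: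
  the q-integral over one variable becomes a sum over its exponent, and the extensions are grouped
  by that exponent. Decay is assumed in variable 1 alone; for the other variables it follows from
  \<open>iterated_q_integral_outside\<close>.\<close>

lemma iterated_q_integral_eq_sum:
  assumes lim: "\<And>x. n \<ge> 1 \<Longrightarrow> x \<in> D \<Longrightarrow> (\<lambda>m. f (x(1 := q ^ m)) * q ^ m) \<longlonglongrightarrow> 0"
  assumes "k \<le> n" "consistent k \<sigma>"
    "\<forall>i\<in>{k<..n}. x i = q ^ \<sigma> i" "\<forall>i. i \<notin> {1..n} \<longrightarrow> x i = undefined"
  shows "iterated_q_integral q n D f k x =
    (1 - q) ^ k * (\<Sum>\<rho>\<in>extensions k \<sigma>. f (point \<rho>) * q ^ (\<Sum>i\<in>{1..k}. \<rho> i))"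
  using assms(2-)
proof (induction k arbitrary: \<sigma> x)
  case 0
  have "extensions 0 \<sigma> = {restrict \<sigma> {1..n}}"
  proof (intro equalityI subsetI)
    fix \<rho> assume "\<rho> \<in> extensions 0 \<sigma>"
    then have "\<rho> i = restrict \<sigma> {1..n} i" for i
      by (auto simp: extensions_def R_D(5))
    then show "\<rho> \<in> {restrict \<sigma> {1..n}}" by auto
  next
    fix \<rho> assume "\<rho> \<in> {restrict \<sigma> {1..n}}"
    with 0(2) show "\<rho> \<in> extensions 0 \<sigma>"
      using P_sub by (fastforce simp: extensions_def R_def P_omega_partitions_def consistent_def)
  qed
  moreover have "x = point (restrict \<sigma> {1..n})"
    using 0 by (auto simp: point_def)
  ultimately show ?case by (simp del: restrict_apply)
next
  case (Suc k)
  let ?k = "Suc k" and ?h = "\<lambda>k \<rho>. f (point \<rho>) * q ^ (\<Sum>i\<in>{1..k}. \<rho> i)"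
  have kn: "?k \<in> {1..n}" using Suc.prems by auto
  show ?case
  proof (cases "fibre n D ?k x = {}")
    case True
    \<comment> \<open>Both sides are 0: an extension would give a point of the empty fibre.\<close>
    have "point \<rho> ?k \<in> fibre n D ?k x" if "\<rho> \<in> extensions ?k \<sigma>" for \<rho>
    proof -
      have "point \<rho> \<in> D" "\<forall>j\<in>{?k<..n}. point \<rho> j = x j"
        using that Suc.prems point_in_D by (auto simp: extensions_def point_def)
      then show ?thesis unfolding fibre_def by blast
    qed
    then have "extensions ?k \<sigma> = {}" using True by blast
    then show ?thesis by (simp add: True)
  next
    case False
    obtain \<alpha> \<beta> where S: "fibre n D ?k x = {q ^ \<alpha>..q ^ \<beta>}" and "\<beta> \<le> \<alpha>"
      and \<alpha>: "\<And>m. m < \<alpha> \<longleftrightarrow> (\<forall>j. (j, ?k) \<in> P \<longrightarrow> m < (if j \<le> ?k then r j else \<sigma> j))"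
      and \<beta>: "\<And>m. \<beta> \<le> m \<longleftrightarrow> (\<forall>j. (?k, j) \<in> P \<longrightarrow> (if j \<le> ?k then s j else \<sigma> j) \<le> m)"
      using fibre_eq[OF kn Suc.prems(3) False] by blast
    define g where "g t = iterated_q_integral q n D f k (x(?k := t))" for t
    have le: "q ^ \<alpha> \<le> q ^ \<beta>" using \<open>\<beta> \<le> \<alpha>\<close> power_le_iff by simp
    have bounds: "(LEAST t. t \<in> {q ^ \<alpha>..q ^ \<beta>}) = q ^ \<alpha>" "(GREATEST t. t \<in> {q ^ \<alpha>..q ^ \<beta>}) = q ^ \<beta>"
      using le by (auto intro!: Least_equality Greatest_equality)
    \<comment> \<open>For the innermost variable this is the hypothesis on \<open>f\<close>; for
      every other one the terms vanish once \<open>q ^ m\<close> falls below the left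
      endpoint.\<close>
    have "(\<lambda>m. g (q ^ m) * q ^ m) \<longlonglongrightarrow> 0"
    proof (cases "k = 0")
      case True
      obtain y where y: "y \<in> D" "\<forall>j\<in>{?k<..n}. y j = x j"
        using False by (auto simp: fibre_def)
      \<comment> \<open>The hypothesis \<open>lim\<close> concerns points of \<open>D\<close>, so
        \<open>x\<close> is traded for a \<open>y\<close> in \<open>D\<close> that can differ from
        it only in coordinate 1.\<close>
      have "x(1 := t) = y(1 := t)" for t
      proof
        fix i
        show "(x(1 := t)) i = (y(1 := t)) i"
        proof (cases "i \<in> {1..n}")
          case False
          then have "y i = undefined"
            using y(1) by (auto simp: D_def truncated_order_polytope_def PiE_iff extensional_def)
          then show ?thesis using Suc.prems(4) False by auto
        qed (use y(2) True in auto)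
      qed
      then show ?thesis using lim[OF _ y(1)] kn True by (simp add: g_def)
    next
      case False
      have "g (q ^ m) * q ^ m = 0" if "m > \<alpha>" for m
      proof -
        have "fibre n D ?k (x(?k := q ^ m)) = fibre n D ?k x"
          by (simp add: fibre_def)
        then have "(x(?k := q ^ m)) ?k \<notin> fibre n D ?k (x(?k := q ^ m))"
          using S that power_le_iff by auto
        then show ?thesis
          using iterated_q_integral_outside[of "x(?k := q ^ m)" ?k f] False kn by (simp add: g_def)
      qed
      then show ?thesis
        by (intro tendsto_eventually eventually_sequentiallyI[of "Suc \<alpha>"]) auto
    qed
    then have I: "iterated_q_integral q n D f ?k x
        = (1 - q) * (\<Sum>m\<in>{\<beta>..<\<alpha>}. g (q ^ m) * q ^ m)"
      using q_integral_powers[OF \<open>\<beta> \<le> \<alpha>\<close>] le by (simp add: S bounds g_def[symmetric] del: atLeastAtMost_iff)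
    have "g (q ^ m) * q ^ m = (1 - q) ^ k * (\<Sum>\<rho>\<in>{\<rho>\<in>extensions ?k \<sigma>. \<rho> ?k = m}. ?h ?k \<rho>)"
      if m: "m \<in> {\<beta>..<\<alpha>}" for m
    proof -
      have lo: "m < (if j \<le> ?k then r j else \<sigma> j)" if "(j, ?k) \<in> P" for j
        using m \<alpha>[of m] that by auto
      have hi: "(if j \<le> ?k then s j else \<sigma> j) \<le> m" if "(?k, j) \<in> P" for j
        using m \<beta>[of m] that by auto
      have kk: "(?k, ?k) \<in> P" using P kn by (meson partial_order_onD(1) refl_onD)
      have split: "i \<in> {k<..n} \<longleftrightarrow> i = ?k \<or> i \<in> {?k<..n}" for i using kn by auto
      \<comment> \<open>An outer index above \<open>?k\<close> in \<open>P\<close> needs only a weak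
        inequality, matching the closed end \<open>\<beta>\<close>; an outer index below
        \<open>?k\<close> in \<open>P\<close> has the larger label and needs a strict one, matching
        the open end \<open>\<alpha>\<close>.\<close>
      have "consistent k (\<sigma>(?k := m))"
        unfolding consistent_def
      proof (intro conjI ballI impI)
        fix i assume i: "i \<in> {k<..n}"
        show "s i \<le> (\<sigma>(?k := m)) i" "(\<sigma>(?k := m)) i < r i"
          using i lo[OF kk] hi[OF kk] Suc.prems(2) unfolding split consistent_def by auto
        fix j assume j: "j \<in> {k<..n}" and ij: "(i, j) \<in> P"
        show "(\<sigma>(?k := m)) j \<le> (\<sigma>(?k := m)) i"
          using i j ij lo[of i] hi[of j] Suc.prems(2) unfolding split consistent_def by auto
        show "(\<sigma>(?k := m)) j < (\<sigma>(?k := m)) i" if "j < i"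
          using that i j ij lo[of i] hi[of j] Suc.prems(2) unfolding split consistent_def by auto
      qed
      then have "g (q ^ m) = (1 - q) ^ k * (\<Sum>\<rho>\<in>extensions k (\<sigma>(?k := m)). ?h k \<rho>)"
        unfolding g_def using Suc.prems kn by (intro Suc.IH) (auto simp del: fun_upd_apply, auto)
      moreover have "extensions k (\<sigma>(?k := m)) = {\<rho>\<in>extensions ?k \<sigma>. \<rho> ?k = m}"
        unfolding extensions_def Ball_def split by auto
      ultimately have "g (q ^ m) * q ^ m
          = (1 - q) ^ k * (\<Sum>\<rho>\<in>{\<rho>\<in>extensions ?k \<sigma>. \<rho> ?k = m}. ?h k \<rho> * q ^ m)"
        by (simp add: sum_distrib_right mult.assoc)
      also have "(\<Sum>\<rho>\<in>{\<rho>\<in>extensions ?k \<sigma>. \<rho> ?k = m}. ?h k \<rho> * q ^ m)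
          = (\<Sum>\<rho>\<in>{\<rho>\<in>extensions ?k \<sigma>. \<rho> ?k = m}. ?h ?k \<rho>)"
        by (intro sum.cong) (auto simp: power_add)
      finally show ?thesis .
    qed
    then have "(\<Sum>m\<in>{\<beta>..<\<alpha>}. g (q ^ m) * q ^ m)
        = (1 - q) ^ k * (\<Sum>m\<in>{\<beta>..<\<alpha>}. \<Sum>\<rho>\<in>{\<rho>\<in>extensions ?k \<sigma>. \<rho> ?k = m}. ?h ?k \<rho>)"
      by (simp add: sum_distrib_left)
    \<comment> \<open>Each extension is counted once, under its value at \<open>?k\<close>. That
      this value lies in \<open>{\<beta>..<\<alpha>}\<close> is the converse of the consistency
      check.\<close>
    also have "(\<Sum>m\<in>{\<beta>..<\<alpha>}. \<Sum>\<rho>\<in>{\<rho>\<in>extensions ?k \<sigma>. \<rho> ?k = m}. ?h ?k \<rho>)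
        = (\<Sum>\<rho>\<in>extensions ?k \<sigma>. ?h ?k \<rho>)"
    proof (rule sum.group)
      show "finite (extensions ?k \<sigma>)" using finite_R by (simp add: extensions_def)
      show "(\<lambda>\<rho>. \<rho> ?k) ` extensions ?k \<sigma> \<subseteq> {\<beta>..<\<alpha>}"
      proof clarsimp
        fix \<rho> assume "\<rho> \<in> extensions ?k \<sigma>"
        then have \<rho>: "\<rho> \<in> R" "\<And>i. i \<in> {?k<..n} \<Longrightarrow> \<sigma> i = \<rho> i"
          by (auto simp: extensions_def)
        have "(if j \<le> ?k then s j else \<sigma> j) \<le> \<rho> ?k" if "(?k, j) \<in> P" for j
          using R_D(1)[OF \<rho>(1), of j] R_D(3)[OF \<rho>(1) that] \<rho>(2)[of j] P_sub[OF that] by auto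
        moreover have "\<rho> ?k < (if j \<le> ?k then r j else \<sigma> j)" if "(j, ?k) \<in> P" for j
          using R_D(2)[OF \<rho>(1), of j] R_D(3,4)[OF \<rho>(1) that] \<rho>(2)[of j] P_sub[OF that] by auto
        ultimately show "\<beta> \<le> \<rho> ?k \<and> \<rho> ?k < \<alpha>" using \<alpha> \<beta> by blast
      qed
    qed simp
    finally show ?thesis unfolding I by (simp only: power_Suc mult.assoc)
  qed
qed

section \<open>The full integral and the decay condition on the integrand\<close>

lemma polytope_q_integral_eq_sum:
  assumes "\<And>x. n \<ge> 1 \<Longrightarrow> x \<in> D \<Longrightarrow> (\<lambda>m. f (x(1 := q ^ m)) * q ^ m) \<longlonglongrightarrow> 0"
  shows "polytope_q_integral q n D f =
    (1 - q) ^ n * (\<Sum>\<rho>\<in>R. f (point \<rho>) * q ^ (\<Sum>i\<in>{1..n}. \<rho> i))"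
proof -
  have "extensions n \<sigma> = R" for \<sigma> by (simp add: extensions_def)
  then show ?thesis
    unfolding polytope_q_integral_def
    by (subst iterated_q_integral_eq_sum[OF assms]) (auto simp: consistent_def)
qed

text \<open>Extension by zero makes the decay automatic: for \<open>m > r 1\<close> the first
  coordinate has left the box.\<close>

lemma restricted_tendsto_zero:
  assumes "n \<ge> 1"
  shows "(\<lambda>m. (if x(1 := q ^ m) \<in> D then f (x(1 := q ^ m)) else 0) * q ^ m) \<longlonglongrightarrow> 0"
proof (rule tendsto_eventually, rule eventually_sequentiallyI)
  fix m assume "Suc (r 1) \<le> m"
  then have "\<not> q ^ r 1 \<le> q ^ m" by (simp add: power_le_iff)
  then have "x(1 := q ^ m) \<notin> D"
    using assms by (force simp: D_def truncated_order_polytope_def PiE_iff)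
  then show "(if x(1 := q ^ m) \<in> D then f (x(1 := q ^ m)) else 0) * q ^ m = 0" by simp
qed

end

text \<open>The innermost q-integral also samples its integrand below the left endpoint, outside
  \<open>D\<close>, where an arbitrary \<open>f\<close> may prevent convergence. Hence two readings:
  \<open>f\<close> extended by zero outside \<open>D\<close>, or \<open>f\<close> itself with
  convergent innermost series, whose terms then tend to 0.\<close>

theorem theorem4p1:
  fixes q :: real and n :: nat and P :: "nat rel" and r s :: "nat \<Rightarrow> nat"
    and f :: "(nat \<Rightarrow> real) \<Rightarrow> real" and I D :: "(nat \<Rightarrow> real) set" and rhs :: real
  assumes q: "0 < q" "q < 1"
    and P: "partial_order_on {1..n} P"
    and rs: "\<forall>i\<in>{1..n}. s i \<le> r i"
  defines "I \<equiv> (\<Pi>\<^sub>E i\<in>{1..n}. {q ^ r i .. q ^ s i})"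
    and "D \<equiv> truncated_order_polytope I P"
    and "rhs \<equiv> (1 - q) ^ n *
           (\<Sum>\<sigma> | \<sigma> \<in> P_omega_partitions {1..n} P (\<lambda>i. i) \<and> (\<forall>i\<in>{1..n}. s i \<le> \<sigma> i \<and> \<sigma> i < r i).
              f (\<lambda>i\<in>{1..n}. q ^ \<sigma> i) * q ^ (\<Sum>i\<in>{1..n}. \<sigma> i))"
  shows "polytope_q_integral q n D (\<lambda>x. if x \<in> D then f x else 0) = rhs \<and>
    ((\<forall>x\<in>D. summable (\<lambda>k. f (x(1 := q ^ k)) * q ^ k)) \<longrightarrow> polytope_q_integral q n D f = rhs)"
proof -
  interpret Q: q_polytope q n P r s by unfold_locales (fact q P)+
  have D: "D = Q.D"
    unfolding D_def I_def Q.D_def ..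
  have rhs: "rhs = (1 - q) ^ n * (\<Sum>\<rho>\<in>Q.R. f (Q.point \<rho>) * q ^ (\<Sum>i\<in>{1..n}. \<rho> i))"
    unfolding rhs_def Q.R_def Q.point_def ..
  show ?thesis
  proof (intro conjI impI)
    show "polytope_q_integral q n D (\<lambda>x. if x \<in> D then f x else 0) = rhs"
      unfolding D rhs using Q.restricted_tendsto_zero
      by (subst Q.polytope_q_integral_eq_sum) (simp_all add: Q.point_in_D)
    assume "\<forall>x\<in>D. summable (\<lambda>k. f (x(1 := q ^ k)) * q ^ k)"
    then show "polytope_q_integral q n D f = rhs"
      unfolding D rhs by (intro Q.polytope_q_integral_eq_sum) (blast intro: summable_LIMSEQ_zero)
  qed
qed

end
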